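(* Let $\lambda$ be a nonzero real number. For every $n\in\mathbb{N}$ (that is, $n\ge 1$), $$HF_{n,\lambda}(x)=\sum_{k=1}^{n}{n \brace k}_{\lambda}H_{k,\lambda}\,k!\,x^{k}.$$ In particular, for $x=1$, $$HF_{n,\lambda}=\sum_{k=1}^{n}{n \brace k}_{\lambda}H_{k,\lambda}\,k!.$$
   Context: Fix a nonzero real $\lambda$. All generating functions are formal power series, with $(1+u)^{a}=\sum_{j\ge0}\binom{a}{j}u^{j}$. Notation: $(x)_{0,\lambda}=1$ and $(x)_{n,\lambda}=x(x-\lambda)\cdots(x-(n-1)\lambda)$ for $n\ge1$; $(x)_0=1$ and $(x)_n=x(x-1)\cdots(x-n+1)$ for $n\ge 1$. Degenerate logarithm: $\log_{\lambda}(1+t)=\frac{1}{\lambda}\big((1+t)^{\lambda}-1\big)$. Degenerate exponential: $e_{\lambda}(t)=(1+\lambda t)^{1/\lambda}=\sum_{n\ge0}(1)_{n,\lambda}\frac{t^{n}}{n!}$. Degenerate Stirling numbers of the second kind ${n\brace k}_{\lambda}$: defined by $(x)_{n,\lambda}=\sum_{k=0}^{n}{n \brace k}_{\lambda}(x)_{k}$, $n\ge0$. Degenerate harmonic numbers $H_{n,\lambda}$: defined by $-\frac{\log_{\lambda}(1-t)}{1-t}=\sum_{n=1}^{\infty}H_{n,\lambda}t^{n}$. Degenerate harmonic-Fubini polynomials $HF_{n,\lambda}(x)$: defined by $$-\frac{\log_{\lambda}\big(1-x(e_{\lambda}(t)-1)\big)}{1-x(e_{\lambda}(t)-1)}=\sum_{n=1}^{\infty}HF_{n,\lambda}(x)\frac{t^{n}}{n!}.$$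 Degenerate harmonic-Fubini numbers: $HF_{n,\lambda}=HF_{n,\lambda}(1)$. *)

theory Defs
  imports Complex_Main "HOL-Computational_Algebra.Formal_Power_Series"
begin

definition falling_factorial :: "real \<Rightarrow> nat \<Rightarrow> real" where
  "falling_factorial x n = (\<Prod>i<n. x - real i)"

definition degenerate_falling_factorial :: "real \<Rightarrow> real \<Rightarrow> nat \<Rightarrow> real" where
  "degenerate_falling_factorial l x n = (\<Prod>i<n. x - real i * l)"

(* The series log_l(1 + t) in t. The library series fps_binomial a is (1 + t)^a. *)
definition degenerate_log :: "real \<Rightarrow> real fps" where
  "degenerate_log l = fps_const (1 / l) * (fps_binomial l - 1)"

(* The series e_l(t) = (1 + l t)^(1/l). *)
definition degenerate_exp :: "real \<Rightarrow> real fps" where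
  "degenerate_exp l = fps_binomial (1 / l) oo (fps_const l * fps_X)"

(* The connection coefficients from the falling factorials to the degenerate ones.
   They are 0 for k > n; this convention makes the coefficient function unique
   (lemma degenerate_Stirling2_ex1). *)
definition degenerate_Stirling2 :: "real \<Rightarrow> nat \<Rightarrow> nat \<Rightarrow> real" where
  "degenerate_Stirling2 l n =
     (THE c. (\<forall>x. degenerate_falling_factorial l x n = (\<Sum>k=0..n. c k * falling_factorial x k))
           \<and> (\<forall>k>n. c k = 0))"

definition degenerate_harmonic :: "real \<Rightarrow> nat \<Rightarrow> real" where
  "degenerate_harmonic l n = fps_nth (- (degenerate_log l oo (- fps_X)) / (1 - fps_X)) n"

(* The generating function is exponential, hence the factor fact n. The polynomial is
   given by its values at real x: for each x the defining series is a real power series in t. *)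
definition degenerate_harmonic_Fubini_poly :: "real \<Rightarrow> nat \<Rightarrow> real \<Rightarrow> real" where
  "degenerate_harmonic_Fubini_poly l n x =
     fact n * fps_nth
       (- (degenerate_log l oo (- (fps_const x * (degenerate_exp l - 1))))
          / (1 - fps_const x * (degenerate_exp l - 1))) n"

definition degenerate_harmonic_Fubini :: "real \<Rightarrow> nat \<Rightarrow> real" where
  "degenerate_harmonic_Fubini l n = degenerate_harmonic_Fubini_poly l n 1"

lemma falling_factorial_of_nat_eq_0: "m < k \<Longrightarrow> falling_factorial (real m) k = 0"
  by (auto simp: falling_factorial_def)

lemma falling_factorial_of_nat_same_neq_0: "falling_factorial (real m) m \<noteq> 0"
  by (auto simp: falling_factorial_def)

lemma falling_factorial_coeffs_unique:
  assumes eq: "\<And>x. (\<Sum>k=0..n. c k * falling_factorial x k) = (\<Sum>k=0..n. d k * falling_factorial x k)"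
    and "m \<le> n"
  shows "c m = d m"
  using \<open>m \<le> n\<close>
proof (induction m rule: less_induct)
  case (less m)
  have trunc: "(\<Sum>k=0..n. a k * falling_factorial (real m) k)
      = (\<Sum>k<m. a k * falling_factorial (real m) k) + a m * falling_factorial (real m) m" for a
  proof -
    have "(\<Sum>k=0..n. a k * falling_factorial (real m) k)
        = (\<Sum>k\<in>{..<Suc m}. a k * falling_factorial (real m) k)"
      using less.prems by (intro sum.mono_neutral_right) (auto simp: falling_factorial_of_nat_eq_0)
    then show ?thesis by simp
  qed
  have "(\<Sum>k<m. c k * falling_factorial (real m) k) = (\<Sum>k<m. d k * falling_factorial (real m) k)"
    using less by (intro sum.cong) auto
  then show ?case
    using eq[of "real m"] falling_factorial_of_nat_same_neq_0[of m] by (simp add: trunc)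
qed

lemma degenerate_Stirling2_exists:
  "\<exists>c. (\<forall>x. degenerate_falling_factorial l x n = (\<Sum>k=0..n. c k * falling_factorial x k))
     \<and> (\<forall>k>n. c k = 0)"
proof (induction n)
  case 0
  show ?case
    by (rule exI[of _ "\<lambda>k. if k = 0 then 1 else 0"])
      (simp add: degenerate_falling_factorial_def falling_factorial_def)
next
  case (Suc n)
  then obtain c
    where c: "\<And>x. degenerate_falling_factorial l x n = (\<Sum>k=0..n. c k * falling_factorial x k)"
      and c0: "\<And>k. k > n \<Longrightarrow> c k = 0" by blast
  define d where "d k = (if k = 0 then 0 else c (k - 1)) + (real k - real n * l) * c k" for k
  have "degenerate_falling_factorial l x (Suc n) = (\<Sum>k=0..Suc n. d k * falling_factorial x k)" for x
  proof -
    let ?f = "falling_factorial x"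
    have f: "?f (Suc k) = ?f k * (x - real k)" for k
      by (simp add: falling_factorial_def)
    have "degenerate_falling_factorial l x (Suc n) = (\<Sum>k=0..n. c k * ?f k) * (x - real n * l)"
      by (simp add: degenerate_falling_factorial_def flip: c)
    also have "\<dots> = (\<Sum>k=0..n. c k * ?f (Suc k) + (real k - real n * l) * c k * ?f k)"
      unfolding sum_distrib_right by (intro sum.cong) (auto simp: f algebra_simps)
    also have "\<dots> = (\<Sum>k=0..n. c k * ?f (Suc k)) + (\<Sum>k=0..n. (real k - real n * l) * c k * ?f k)"
      by (rule sum.distrib)
    also have "(\<Sum>k=0..n. c k * ?f (Suc k)) = (\<Sum>k=0..Suc n. (if k = 0 then 0 else c (k - 1)) * ?f k)"
      by (subst sum.atLeast0_atMost_Suc_shift) simp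
    also have "(\<Sum>k=0..n. (real k - real n * l) * c k * ?f k)
        = (\<Sum>k=0..Suc n. (real k - real n * l) * c k * ?f k)"
      by (simp add: c0)
    finally show ?thesis
      unfolding d_def by (simp only: sum.distrib distrib_right)
  qed
  moreover have "d k = 0" if "k > Suc n" for k
    using that by (simp add: d_def c0)
  ultimately show ?case by blast
qed

lemma degenerate_Stirling2_ex1:
  "\<exists>!c. (\<forall>x. degenerate_falling_factorial l x n = (\<Sum>k=0..n. c k * falling_factorial x k))
     \<and> (\<forall>k>n. c k = 0)"
proof (rule ex_ex1I[OF degenerate_Stirling2_exists])
  fix c d
  assume c: "(\<forall>x. degenerate_falling_factorial l x n = (\<Sum>k=0..n. c k * falling_factorial x k))
      \<and> (\<forall>k>n. c k = 0)"
    and d: "(\<forall>x. degenerate_falling_factorial l x n = (\<Sum>k=0..n. d k * falling_factorial x k))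
      \<and> (\<forall>k>n. d k = 0)"
  have "c k = d k" for k
  proof (cases "k \<le> n")
    case True
    show ?thesis
      by (rule falling_factorial_coeffs_unique[OF _ True]) (use c d in metis)
  qed (use c d in auto)
  then show "c = d" by blast
qed

lemma degenerate_Stirling2:
  shows degenerate_falling_factorial_eq_sum:
      "degenerate_falling_factorial l x n
         = (\<Sum>k=0..n. degenerate_Stirling2 l n k * falling_factorial x k)"
    and degenerate_Stirling2_eq_0: "n < k \<Longrightarrow> degenerate_Stirling2 l n k = 0"
  using theI'[OF degenerate_Stirling2_ex1[of l n]] unfolding degenerate_Stirling2_def by blast+

lemma degenerate_exp_nth:
  assumes "l \<noteq> 0"
  shows "fps_nth (degenerate_exp l) n = degenerate_falling_factorial l 1 n / fact n"
proof -
  have "fps_nth (degenerate_exp l) n = l ^ n * ((1 / l) gchoose n)"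
    by (simp add: degenerate_exp_def fps_compose_linear)
  also have "\<dots> = (\<Prod>i<n. l * (1 / l - real i)) / fact n"
    by (simp add: gbinomial_prod_rev prod.distrib atLeast0LessThan)
  also have "(\<Prod>i<n. l * (1 / l - real i)) = degenerate_falling_factorial l 1 n"
    unfolding degenerate_falling_factorial_def
    using assms by (intro prod.cong) (auto simp: field_simps)
  finally show ?thesis .
qed

end

theory Submission
  imports Defs
begin

text \<open>
  With \<open>G(u) = - log\<^sub>l(1 - u) / (1 - u)\<close>, whose coefficients are the degenerate harmonic numbers,
  the generating function of the harmonic-Fubini polynomials is the composition
  \<open>G(x (e\<^sub>l(t) - 1))\<close> (lemma \<open>degenerate_harmonic_gf_compose\<close>). Expanding it in powers of
  \<open>e\<^sub>l(t) - 1\<close> reduces the theorem to the exponential generating function of the degenerate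
  Stirling numbers: the coefficient of \<open>t\<^sup>n\<close> in \<open>(e\<^sub>l(t) - 1)\<^sup>k\<close> is \<open>k!/n!\<close> times the Stirling
  number (lemma \<open>degenerate_exp_minus_1_power_nth\<close>). The term \<open>k = 0\<close> drops out because \<open>G\<close> has
  no constant term.

  Since the Stirling numbers are defined only as connection coefficients, their generating
  function comes from comparing two expansions of \<open>e\<^sub>l(t)\<^sup>x\<close>, for an arbitrary real exponent \<open>x\<close>.
  Read as the binomial series \<open>(1 + u)\<^sup>x\<close> at \<open>u = e\<^sub>l(t) - 1\<close>, it is a combination of ordinary
  falling factorials of \<open>x\<close> with coefficients \<open>(e\<^sub>l(t) - 1)\<^sup>k / k!\<close>. Read through the differential
  equation \<open>(1 + l t) F' = x F\<close>, its coefficients are the degenerate falling factorials of \<open>x\<close>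
  over \<open>n!\<close> (lemma \<open>binomial_series_compose_degenerate_exp_nth\<close>). As connection coefficients are
  unique, the two readings identify the Stirling numbers.
\<close>

lemma falling_factorial_eq_gbinomial: "falling_factorial x k = fact k * (x gchoose k)"
  by (simp add: falling_factorial_def gbinomial_prod_rev atLeast0LessThan)

lemma degenerate_exp_nth_0 [simp]: "fps_nth (degenerate_exp l) 0 = 1"
  by (simp add: degenerate_exp_def)

text \<open>
  Equations for \<open>(1 + c t) f'\<close> are two-term recurrences for the coefficients; both differential
  equations below, for \<open>e\<^sub>l(t)\<close> and for \<open>e\<^sub>l(t)\<^sup>x\<close>, have this form with \<open>c = l\<close>.
\<close>

lemma fps_nth_one_plus_cX_deriv:
  fixes f :: "'a::comm_ring_1 fps"
  shows "fps_nth ((1 + fps_const c * fps_X) * fps_deriv f) n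
    = of_nat (Suc n) * fps_nth f (Suc n) + c * of_nat n * fps_nth f n"
  by (cases n) (simp_all add: ring_distribs mult.assoc)

lemma degenerate_exp_ODE:
  assumes "l \<noteq> 0"
  shows "(1 + fps_const l * fps_X) * fps_deriv (degenerate_exp l) = degenerate_exp l"
proof (rule fps_ext)
  fix n
  have "degenerate_falling_factorial l 1 (Suc n)
      = degenerate_falling_factorial l 1 n * (1 - real n * l)"
    by (simp add: degenerate_falling_factorial_def)
  then have "real (Suc n) * fps_nth (degenerate_exp l) (Suc n)
      = (1 - real n * l) * fps_nth (degenerate_exp l) n"
    by (simp add: degenerate_exp_nth[OF assms] divide_simps)
  then show "fps_nth ((1 + fps_const l * fps_X) * fps_deriv (degenerate_exp l)) n
      = fps_nth (degenerate_exp l) n"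
    unfolding fps_nth_one_plus_cX_deriv by (simp add: algebra_simps)
qed

text \<open>
  The left-hand series is \<open>e\<^sub>l(t)\<^sup>x\<close>. By the chain rule, the equation \<open>(1 + u) B' = x B\<close> of the
  binomial series and that of \<open>e\<^sub>l\<close> combine to \<open>(1 + l t) F' = x F\<close>. Its recurrence multiplies by
  \<open>x - n l\<close>, which is the next factor of the degenerate falling factorial.
\<close>

lemma binomial_series_compose_degenerate_exp_nth:
  assumes "l \<noteq> 0"
  shows "fps_nth (fps_binomial x oo (degenerate_exp l - 1)) n
    = degenerate_falling_factorial l x n / fact n"
proof -
  let ?e = "degenerate_exp l"
  define F where "F = fps_binomial x oo (?e - 1)"
  define D where "D = fps_deriv (fps_binomial x) oo (?e - 1)"
  \<comment> \<open>The substitution turns \<open>1 + u\<close> into \<open>e\<^sub>l(t)\<close>, which is also what \<open>1 + l t\<close> makes of the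
      inner derivative in the chain rule, so the same product \<open>e\<^sub>l(t) D\<close> arises in both equations.\<close>
  have "(1 + fps_X) * fps_deriv (fps_binomial x) = fps_const x * fps_binomial x"
    by (rule fps_ext) (auto simp: fps_binomial_deriv field_simps)
  then have "((1 + fps_X) * fps_deriv (fps_binomial x)) oo (?e - 1)
      = (fps_const x * fps_binomial x) oo (?e - 1)"
    by (rule arg_cong)
  then have D: "?e * D = fps_const x * F"
    by (simp add: fps_compose_mult_distrib fps_compose_add_distrib D_def F_def)
  have "(1 + fps_const l * fps_X) * fps_deriv F
      = D * ((1 + fps_const l * fps_X) * fps_deriv ?e)"
    by (simp add: F_def D_def fps_compose_deriv mult_ac)
  also have "\<dots> = fps_const x * F"
    using D degenerate_exp_ODE[OF assms] by (simp add: mult.commute)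
  finally have ODE: "(1 + fps_const l * fps_X) * fps_deriv F = fps_const x * F" .
  have rec: "real (Suc m) * fps_nth F (Suc m) = (x - real m * l) * fps_nth F m" for m
    using arg_cong[OF ODE, of "\<lambda>f. fps_nth f m"]
    unfolding fps_nth_one_plus_cX_deriv by (simp add: algebra_simps)
  have "fps_nth F n = degenerate_falling_factorial l x n / fact n"
  proof (induction n)
    case 0
    show ?case by (simp add: F_def degenerate_falling_factorial_def)
  next
    case (Suc n)
    have "fps_nth F (Suc n) = (x - real n * l) * fps_nth F n / real (Suc n)"
      using rec[of n] by (simp add: field_simps)
    also have "\<dots> = degenerate_falling_factorial l x (Suc n) / fact (Suc n)"
      by (simp add: Suc.IH degenerate_falling_factorial_def field_simps)
    finally show ?case .
  qed
  then show ?thesis by (simp add: F_def)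
qed

text \<open>
  Both sides, suitably scaled, are coefficients of the same polynomial in \<open>x\<close>, namely \<open>n!\<close> times
  the coefficient of \<open>t\<^sup>n\<close> in \<open>e\<^sub>l(t)\<^sup>x\<close>, with respect to the basis of falling factorials.
\<close>

lemma degenerate_exp_minus_1_power_nth:
  assumes "l \<noteq> 0" and "k \<le> n"
  shows "fps_nth ((degenerate_exp l - 1) ^ k) n = fact k / fact n * degenerate_Stirling2 l n k"
proof -
  have "(\<Sum>j=0..n. degenerate_Stirling2 l n j * falling_factorial x j)
      = (\<Sum>j=0..n. (fact n / fact j * fps_nth ((degenerate_exp l - 1) ^ j) n)
                      * falling_factorial x j)" for x
  proof -
    have "(\<Sum>j=0..n. degenerate_Stirling2 l n j * falling_factorial x j)
        = fact n * fps_nth (fps_binomial x oo (degenerate_exp l - 1)) n"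
      by (simp add: binomial_series_compose_degenerate_exp_nth[OF assms(1)]
          flip: degenerate_falling_factorial_eq_sum)
    also have "\<dots> = (\<Sum>j=0..n. (fact n / fact j * fps_nth ((degenerate_exp l - 1) ^ j) n)
                      * falling_factorial x j)"
      by (simp add: fps_compose_nth falling_factorial_eq_gbinomial sum_distrib_left mult_ac)
    finally show ?thesis .
  qed
  from falling_factorial_coeffs_unique[OF this assms(2)] show ?thesis
    by (simp add: field_simps)
qed

lemma degenerate_harmonic_0 [simp]: "degenerate_harmonic l 0 = 0"
  by (simp add: degenerate_harmonic_def degenerate_log_def)

text \<open>
  Substitution of \<open>u\<close> commutes with the quotient because \<open>1 - t\<close> has invertible constant term, and
  with the inner substitution of \<open>- t\<close> by associativity; both need \<open>u\<close> to vanish at \<open>0\<close>.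
\<close>

lemma degenerate_harmonic_gf_compose:
  "- (degenerate_log l oo (- u)) / (1 - u) = Abs_fps (degenerate_harmonic l) oo u"
  if "fps_nth u 0 = 0" for u :: "real fps"
proof -
  have G: "Abs_fps (degenerate_harmonic l) = - (degenerate_log l oo (- fps_X)) / (1 - fps_X)"
    by (simp add: degenerate_harmonic_def fps_eq_iff)
  have "Abs_fps (degenerate_harmonic l) oo u
      = ((- (degenerate_log l oo (- fps_X))) oo u) / ((1 - fps_X) oo u)"
    unfolding G by (rule fps_divide_compose) (simp_all add: that)
  also have "(- (degenerate_log l oo (- fps_X))) oo u = - (degenerate_log l oo (- u))"
    using that by (simp add: fps_compose_uminus fps_compose_assoc[symmetric])
  finally show ?thesis
    using that by (simp add: fps_compose_sub_distrib)
qed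

theorem theorem1:
  fixes l :: real and n :: nat
  assumes "l \<noteq> 0" and "n \<ge> 1"
  shows "(\<forall>x::real. degenerate_harmonic_Fubini_poly l n x =
            (\<Sum>k=1..n. degenerate_Stirling2 l n k * degenerate_harmonic l k * fact k * x ^ k))
       \<and> degenerate_harmonic_Fubini l n =
            (\<Sum>k=1..n. degenerate_Stirling2 l n k * degenerate_harmonic l k * fact k)"
proof -
  have main: "degenerate_harmonic_Fubini_poly l n x =
      (\<Sum>k=1..n. degenerate_Stirling2 l n k * degenerate_harmonic l k * fact k * x ^ k)" for x
  proof -
    let ?u = "fps_const x * (degenerate_exp l - 1)"
    have "degenerate_harmonic_Fubini_poly l n x
        = fact n * fps_nth (Abs_fps (degenerate_harmonic l) oo ?u) n"
      unfolding degenerate_harmonic_Fubini_poly_def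
      by (subst degenerate_harmonic_gf_compose) simp_all
    also have "\<dots> = (\<Sum>k=0..n. fact n * (degenerate_harmonic l k
        * (x ^ k * fps_nth ((degenerate_exp l - 1) ^ k) n)))"
      by (simp add: fps_compose_nth sum_distrib_left power_mult_distrib fps_const_power)
    also have "\<dots> = (\<Sum>k=0..n. degenerate_Stirling2 l n k * degenerate_harmonic l k * fact k * x ^ k)"
      by (intro sum.cong) (simp_all add: degenerate_exp_minus_1_power_nth[OF assms(1)])
    also have "\<dots> = (\<Sum>k=1..n. degenerate_Stirling2 l n k * degenerate_harmonic l k * fact k * x ^ k)"
      by (simp add: sum.atLeast_Suc_atMost)
    finally show ?thesis .
  qed
  then show ?thesis
    by (simp add: degenerate_harmonic_Fubini_def)
qed

end
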